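(* Let $0<q<\infty$ and $f\in C_c^1(\mathbb{R}^n)$. Then, for every $x\in\mathbb{R}^n$, $$\lim_{s\to1^-}\bigl(q(1-s)\bigr)^{1/q}\mathcal D_{s,q}f(x)=K_{n,q}^{1/q}|\nabla f(x)|.$$
   Context: For $0<s<1$, $\mathcal D_{s,q}f(x):=\left(\int_{\mathbb{R}^n}\frac{|f(x)-f(y)|^q}{|x-y|^{n+sq}}\,dy\right)^{1/q}$. $K_{n,q}:=\int_{\mathbb S^{n-1}}|e\cdot\theta|^q\,d\theta$ for any unit vector $e\in\mathbb S^{n-1}$ (the value is independent of $e$), with $d\theta$ surface measure. *)

theory Defs
  imports "HOL-Analysis.Analysis"
begin

(* The unique D with GDERIV f x :> D; meaningful only where f is differentiable. *)
definition grad :: "('a::euclidean_space \<Rightarrow> real) \<Rightarrow> 'a \<Rightarrow> 'a" where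
  "grad f x = (THE D. GDERIV f x :> D)"

lemma gderiv_grad:
  fixes f :: "'a::euclidean_space \<Rightarrow> real"
  assumes "f differentiable (at x)"
  shows "GDERIV f x :> grad f x"
proof -
  obtain f' where f': "(f has_derivative f') (at x)"
    using assms by (auto simp: differentiable_def)
  then interpret bounded_linear f' by (rule has_derivative_bounded_linear)
  have "f' h = h \<bullet> adjoint f' 1" for h
    using adjoint_works[OF linear_axioms, of h 1] by simp
  hence "f' = (\<lambda>h. h \<bullet> adjoint f' 1)" by (rule ext)
  with f' have ex: "GDERIV f x :> adjoint f' 1"
    unfolding gderiv_def by (rule has_derivative_eq_rhs)
  have "D = adjoint f' 1" if D: "GDERIV f x :> D" for D
  proof -
    have "(\<lambda>h. h \<bullet> D) = (\<lambda>h. h \<bullet> adjoint f' 1)"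
      using D ex unfolding gderiv_def by (rule has_derivative_unique)
    hence "\<forall>h. h \<bullet> D = h \<bullet> adjoint f' 1" by (rule fun_cong[THEN allI])
    thus ?thesis by (simp only: vector_eq_ldot)
  qed
  with ex show ?thesis
    unfolding grad_def by (rule theI[where P = "\<lambda>D. GDERIV f x :> D"])
qed

definition C1_compact_support :: "('a::euclidean_space \<Rightarrow> real) \<Rightarrow> bool" where
  "C1_compact_support f \<longleftrightarrow>
     (\<forall>x. f differentiable (at x)) \<and> continuous_on UNIV (grad f) \<and>
     compact (closure (support_on UNIV f))"

(* The power a^p for p > 0, on [0,\<infinity>]. *)
definition ennreal_powr :: "ennreal \<Rightarrow> real \<Rightarrow> ennreal" where
  "ennreal_powr a p = (if a = \<infinity> then \<infinity> else ennreal (enn2real a powr p))"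

(* Values in [0,\<infinity>], so divergence of the integral is not hidden by a default value.
   On the null set y = x the integrand reads 0 / 0 = 0. *)
definition frac_deriv :: "real \<Rightarrow> real \<Rightarrow> ('a::euclidean_space \<Rightarrow> real) \<Rightarrow> 'a \<Rightarrow> ennreal" where
  "frac_deriv s q f x =
     ennreal_powr
       (\<integral>\<^sup>+ y. ennreal (\<bar>f x - f y\<bar> powr q / norm (x - y) powr (real DIM('a) + s * q)) \<partial>lborel)
       (1 / q)"

(* Surface measure as the cone measure n * vol {t \<theta>. 0 < t < 1, \<theta> \<in> A}, i.e. the measure that
   makes the polar coordinate formula hold (see emeasure_sphere_measure below).
   Note sgn x = x / |x| for x \<noteq> 0. *)
definition sphere_measure :: "'a::euclidean_space measure" where
  "sphere_measure =
     scale_measure (of_nat DIM('a))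
       (distr (restrict_space lborel (ball 0 1 - {0})) (restrict_space borel (sphere 0 1)) sgn)"

lemma space_sphere_measure [simp]: "space sphere_measure = sphere 0 1"
  by (simp add: sphere_measure_def space_scale_measure space_restrict_space)

lemma sets_sphere_measure [simp, measurable_cong]:
  "sets sphere_measure = sets (restrict_space borel (sphere 0 1))"
  by (simp add: sphere_measure_def)

lemma emeasure_sphere_measure:
  fixes A :: "'a::euclidean_space set"
  assumes A: "A \<in> sets borel" "A \<subseteq> sphere 0 1"
  shows "emeasure sphere_measure A =
           of_nat DIM('a) * emeasure lborel {t *\<^sub>R \<theta> | t \<theta>. 0 < t \<and> t < 1 \<and> \<theta> \<in> A}"
proof -
  let ?B = "ball 0 1 - {0::'a}"
  have sgn_meas: "sgn \<in> measurable borel (borel :: 'a measure)"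
    unfolding sgn_div_norm by measurable
  have m: "sgn \<in> measurable (restrict_space lborel ?B) (restrict_space borel (sphere 0 1))"
    by (rule measurable_restrict_space3)
      (use sgn_meas in \<open>auto simp: norm_sgn measurable_lborel2\<close>)
  have As: "A \<in> sets (restrict_space borel (sphere 0 1))"
    using A by (auto simp: sets_restrict_space_iff)
  have eq: "sgn -` A \<inter> ?B = {t *\<^sub>R \<theta> | t \<theta>. 0 < t \<and> t < 1 \<and> \<theta> \<in> A}" (is "?L = ?R")
  proof (intro equalityI subsetI)
    fix x assume "x \<in> ?L"
    hence "x = norm x *\<^sub>R sgn x" "0 < norm x" "norm x < 1" "sgn x \<in> A"
      by (auto simp: sgn_div_norm)
    thus "x \<in> ?R" by blast
  next
    fix x assume "x \<in> ?R"
    then obtain t \<theta> where x: "x = t *\<^sub>R \<theta>" "0 < t" "t < 1" "\<theta> \<in> A" by blast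
    with A(2) have "norm \<theta> = 1" "\<theta> \<noteq> 0" by auto
    with x show "x \<in> ?L" by (simp add: sgn_div_norm)
  qed
  have "emeasure sphere_measure A =
          of_nat DIM('a) * emeasure (restrict_space lborel ?B) (sgn -` A \<inter> ?B)"
    by (simp add: sphere_measure_def emeasure_distr[OF m As] space_restrict_space)
  also have "emeasure (restrict_space lborel ?B) (sgn -` A \<inter> ?B) = emeasure lborel ?L"
    by (subst emeasure_restrict_space) auto
  finally show ?thesis by (simp only: eq)
qed

(* For a unit vector e, by rotation invariance, the value does not depend on e. *)
definition K_const :: "'a::euclidean_space \<Rightarrow> real \<Rightarrow> real" where
  "K_const e q = (\<integral>\<theta>. \<bar>e \<bullet> \<theta>\<bar> powr q \<partial>sphere_measure)"

end

theory Submission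
  imports Defs
begin

text \<open>Near \<open>x\<close> the integrand, as a function of \<open>h = y - x\<close>, is
  \<open>\<bar>\<nabla>f x \<bullet> sgn h\<bar> powr q * norm h powr (a - n)\<close> with \<open>a = q * (1 - s)\<close>, up to a small
  multiple of \<open>norm h powr (a - n)\<close>. Its integral over
  a ball of radius \<open>\<delta>\<close> is \<open>\<delta> powr a / a\<close> times the spherical integral of
  \<open>\<bar>\<nabla>f x \<bullet> \<theta>\<bar> powr q\<close>, which is \<open>K * norm (\<nabla>f x) powr q\<close> by rotation invariance; the part
  outside the ball stays bounded and is killed by the factor \<open>a \<longlonglongrightarrow> 0\<close>. Polar coordinates
  are replaced by the layer cake formula for a negative power of the norm, and the homogeneity of
  Lebesgue measure.\<close>

section \<open>Changes of variable for Lebesgue measure\<close>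

lemma nn_integral_lborel_affine:
  fixes F :: "'a::euclidean_space \<Rightarrow> ennreal"
  assumes [measurable]: "F \<in> borel_measurable borel" and "c \<noteq> 0"
  shows "(\<integral>\<^sup>+ x. F x \<partial>lborel) = ennreal (\<bar>c\<bar> ^ DIM('a)) * (\<integral>\<^sup>+ x. F (t + c *\<^sub>R x) \<partial>lborel)"
  by (subst lborel_affine[OF assms(2), of t])
    (simp add: nn_integral_density nn_integral_distr nn_integral_cmult)

lemma nn_integral_lborel_translate:
  fixes F :: "'a::euclidean_space \<Rightarrow> ennreal"
  assumes "F \<in> borel_measurable borel"
  shows "(\<integral>\<^sup>+ x. F (x + t) \<partial>lborel) = (\<integral>\<^sup>+ x. F x \<partial>lborel)"
  using nn_integral_lborel_affine[OF assms, of 1 t] by (simp add: add.commute)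

lemma nn_integral_lborel_reflect:
  fixes F :: "'a::euclidean_space \<Rightarrow> ennreal"
  assumes "F \<in> borel_measurable borel"
  shows "(\<integral>\<^sup>+ x. F (t - x) \<partial>lborel) = (\<integral>\<^sup>+ x. F x \<partial>lborel)"
  using nn_integral_lborel_affine[OF assms, of "-1" t] by simp

lemma pred_ball [measurable]:
  "Measurable.pred borel (\<lambda>x. x \<in> ball (c::'a::euclidean_space) r)"
  by simp

lemma emeasure_unit_ball_nontrivial:
  "emeasure lborel (ball (0::'a::euclidean_space) 1) \<noteq> 0"
  "emeasure lborel (ball (0::'a::euclidean_space) 1) \<noteq> \<infinity>"
  using unit_ball_vol_pos[of "real DIM('a)", THEN less_imp_neq] by (simp_all add: emeasure_ball)

text \<open>Uniqueness of Haar measure in miniature: integrating \<open>\<phi> (T y) * indicator (ball 0 1) x\<close> in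
  both orders, after translating \<open>x\<close> by \<open>T y\<close> and then \<open>y\<close> by \<open>T\<^sup>-\<^sup>1 x\<close>, swaps the roles of
  \<open>\<phi>\<close> and of the \<open>T\<close>-invariant ball.\<close>

lemma nn_integral_orthogonal_transformation:
  fixes \<phi> :: "'a::euclidean_space \<Rightarrow> ennreal" and T :: "'a \<Rightarrow> 'a"
  assumes [measurable]: "\<phi> \<in> borel_measurable borel" and T: "orthogonal_transformation T"
  shows "(\<integral>\<^sup>+ y. \<phi> (T y) \<partial>lborel) = (\<integral>\<^sup>+ y. \<phi> y \<partial>lborel)"
proof -
  let ?B = "indicator (ball 0 1) :: 'a \<Rightarrow> ennreal"
  let ?V = "emeasure lborel (ball (0::'a) 1)"
  have lin: "linear T" using T by (rule orthogonal_transformation_linear)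
  have [measurable]: "T \<in> borel_measurable borel"
    using lin by (intro borel_measurable_continuous_onI linear_continuous_on linear_conv_bounded_linear[THEN iffD1])
  have V: "(\<integral>\<^sup>+ x. ?B x \<partial>lborel) = ?V" by simp
  have V': "(\<integral>\<^sup>+ x. ?B (x + t) \<partial>lborel) = ?V" for t
    by (simp only: nn_integral_lborel_translate[of ?B] borel_measurable_indicator borel_open open_ball V)
  have "?V * (\<integral>\<^sup>+ y. \<phi> (T y) \<partial>lborel) = (\<integral>\<^sup>+ y. \<phi> (T y) * (\<integral>\<^sup>+ x. ?B x \<partial>lborel) \<partial>lborel)"
    unfolding V by (simp add: nn_integral_multc mult.commute)
  also have "\<dots> = (\<integral>\<^sup>+ y. (\<integral>\<^sup>+ x. \<phi> (T y) * ?B (x + T y) \<partial>lborel) \<partial>lborel)"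
    by (simp add: nn_integral_cmult V V' del: nn_integral_indicator)
  also have "\<dots> = (\<integral>\<^sup>+ x. (\<integral>\<^sup>+ y. \<phi> (T y) * ?B (x + T y) \<partial>lborel) \<partial>lborel)"
    by (rule lborel_pair.Fubini') simp
  also have "\<dots> = (\<integral>\<^sup>+ x. (\<integral>\<^sup>+ y. \<phi> (T y - x) * ?B y \<partial>lborel) \<partial>lborel)"
  proof (rule nn_integral_cong)
    fix x :: 'a
    obtain z where z: "x = T z"
      using orthogonal_transformation_surj[OF T] by (metis surjD)
    have "(\<integral>\<^sup>+ y. \<phi> (T y) * ?B (x + T y) \<partial>lborel) =
        (\<integral>\<^sup>+ y. \<phi> (T (y + (- z))) * ?B (x + T (y + (- z))) \<partial>lborel)"
      by (rule nn_integral_lborel_translate[symmetric]) simp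
    \<comment> \<open>Shifting \<open>y\<close> by \<open>- z\<close> turns \<open>x + T y\<close>
      into \<open>T y\<close>, which lies in the ball exactly when \<open>y\<close> does.\<close>
    also have "\<dots> = (\<integral>\<^sup>+ y. \<phi> (T y - x) * ?B y \<partial>lborel)"
      by (rule nn_integral_cong)
        (simp add: z linear_diff[OF lin] linear_neg[OF lin] indicator_def orthogonal_transformation_norm[OF T])
    finally show "(\<integral>\<^sup>+ y. \<phi> (T y) * ?B (x + T y) \<partial>lborel) =
      (\<integral>\<^sup>+ y. \<phi> (T y - x) * ?B y \<partial>lborel)" .
  qed
  also have "\<dots> = (\<integral>\<^sup>+ y. (\<integral>\<^sup>+ x. \<phi> (T y - x) * ?B y \<partial>lborel) \<partial>lborel)"
    by (rule lborel_pair.Fubini') simp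
  also have "\<dots> = (\<integral>\<^sup>+ y. (\<integral>\<^sup>+ x. \<phi> x \<partial>lborel) * ?B y \<partial>lborel)"
    by (simp add: nn_integral_multc nn_integral_lborel_reflect)
  also have "\<dots> = ?V * (\<integral>\<^sup>+ x. \<phi> x \<partial>lborel)"
    by (simp add: nn_integral_cmult mult.commute)
  finally show ?thesis
    using emeasure_unit_ball_nontrivial[where 'a='a] by (simp add: ennreal_mult_cancel_left)
qed

section \<open>Integrals of powers of the norm\<close>

lemma nn_integral_powr_tail:
  fixes p a :: real
  assumes "0 < p" "0 < a"
  shows "(\<integral>\<^sup>+ r. ennreal (p * r powr (- p - 1)) * indicator {a<..} r \<partial>lborel) = ennreal (a powr - p)"
proof -
  have "(\<integral>\<^sup>+ r. ennreal (p * r powr (- p - 1)) * indicator {a<..} r \<partial>lborel) =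
      (\<integral>\<^sup>+ r. ennreal (p * r powr (- p - 1)) * indicator {a..} r \<partial>lborel)"
  \<comment> \<open>The half-line is open to match the strict inequality defining open balls; adding
    the null set \<open>{a}\<close> prepares the fundamental theorem on
    \<open>{a..}\<close>.\<close>
  proof (rule nn_integral_cong_AE)
    show "AE r in lborel. ennreal (p * r powr (- p - 1)) * indicator {a<..} r =
        ennreal (p * r powr (- p - 1)) * indicator {a..} r"
      using AE_lborel_singleton[of a] by eventually_elim (auto simp: indicator_def)
  qed
  also have "\<dots> = ennreal (0 - (- (a powr - p)))"
  proof (rule nn_integral_FTC_atLeast[where F = "\<lambda>r. - (r powr - p)"])
    show "((\<lambda>r. - (r powr - p)) has_real_derivative p * r powr (- p - 1)) (at r)" if "a \<le> r" for r
      using that assms by (auto intro!: derivative_eq_intros)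
    have "((\<lambda>r. r powr - p) \<longlongrightarrow> 0) at_top"
      using assms by (intro tendsto_neg_powr filterlim_ident) auto
    from tendsto_minus[OF this] show "((\<lambda>r. - (r powr - p)) \<longlongrightarrow> 0) at_top" by simp
  qed (use assms in auto)
  finally show ?thesis by simp
qed

text \<open>The antiderivative \<open>r powr a / a\<close> is continuous up to 0, while the
  integrand is unbounded near 0 if \<open>a < 1\<close>; so the fundamental theorem is applied with
  the derivative known only in the interior.\<close>

lemma nn_integral_powr_from_0:
  fixes a b :: real
  assumes "0 < a" "0 \<le> b"
  shows "(\<integral>\<^sup>+ r. ennreal (r powr (a - 1)) * indicator {0..b} r \<partial>lborel) = ennreal (b powr a / a)"
proof -
  have "((\<lambda>r. r powr (a - 1)) has_integral (b powr a / a - 0 powr a / a)) {0..b}"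
  proof (rule fundamental_theorem_of_calculus_interior)
    show "continuous_on {0..b} (\<lambda>r. r powr a / a)"
      using assms by (intro continuous_intros continuous_on_powr') auto
    show "((\<lambda>r. r powr a / a) has_vector_derivative r powr (a - 1)) (at r)" if "r \<in> {0<..<b}" for r
      unfolding has_real_derivative_iff_has_vector_derivative[symmetric]
      using that assms by (auto intro!: derivative_eq_intros)
  qed (use assms in auto)
  from nn_integral_has_integral_lebesgue[OF _ this]
  show ?thesis by (simp add: ennreal_mult' ennreal_indicator mult.commute)
qed

text \<open>\<open>norm h powr - p\<close> is a superposition of the indicators of
  \<open>norm h < r\<close> with weight \<open>p * r powr (- p - 1)\<close>. After Tonelli,
  \<open>\<psi>\<close> enters only through its mass on balls around 0.\<close>

lemma nn_integral_layer_cake_powr: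
  fixes \<psi> :: "'a::euclidean_space \<Rightarrow> ennreal"
  assumes [measurable]: "\<psi> \<in> borel_measurable borel" and p: "0 < p"
  shows "(\<integral>\<^sup>+ h. \<psi> h * ennreal (norm h powr - p) \<partial>lborel) =
    (\<integral>\<^sup>+ r. ennreal (p * r powr (- p - 1)) * indicator {0<..} r *
        (\<integral>\<^sup>+ h. \<psi> h * indicator (ball 0 r) h \<partial>lborel) \<partial>lborel)"
proof -
  let ?w = "\<lambda>r. ennreal (p * r powr (- p - 1))"
  have eq: "ennreal (norm h powr - p) = (\<integral>\<^sup>+ r. ?w r * indicator {norm h<..} r \<partial>lborel)"
    if "h \<noteq> 0" for h :: 'a
    using nn_integral_powr_tail[OF p, of "norm h"] that by simp
  have "(\<integral>\<^sup>+ h. \<psi> h * ennreal (norm h powr - p) \<partial>lborel) =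
      (\<integral>\<^sup>+ h. \<psi> h * (\<integral>\<^sup>+ r. ?w r * indicator {norm h<..} r \<partial>lborel) \<partial>lborel)"
  \<comment> \<open>The origin is dropped as a null set: \<open>0 powr - p\<close> is 0, whereas the
    integral on the right diverges for \<open>h = 0\<close>.\<close>
  proof (rule nn_integral_cong_AE)
    show "AE h in lborel. \<psi> h * ennreal (norm h powr - p) =
        \<psi> h * (\<integral>\<^sup>+ r. ?w r * indicator {norm h<..} r \<partial>lborel)"
      using AE_lborel_singleton[of 0] by eventually_elim (simp add: eq)
  qed
  also have "\<dots> = (\<integral>\<^sup>+ h. (\<integral>\<^sup>+ r. \<psi> h * (?w r * of_bool (norm h < r)) \<partial>lborel) \<partial>lborel)"
    by (intro nn_integral_cong) (simp add: nn_integral_cmult[symmetric] indicator_def)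
  also have "\<dots> = (\<integral>\<^sup>+ r. (\<integral>\<^sup>+ h. \<psi> h * (?w r * of_bool (norm h < r)) \<partial>lborel) \<partial>lborel)"
    by (rule lborel_pair.Fubini'[symmetric]) simp
  also have "\<dots> = (\<integral>\<^sup>+ r. ?w r * indicator {0<..} r * (\<integral>\<^sup>+ h. \<psi> h * indicator (ball 0 r) h \<partial>lborel) \<partial>lborel)"
  proof (rule nn_integral_cong)
    \<comment> \<open>\<open>norm h < r\<close> forces \<open>0 < r\<close>, so the indicator of the
      positive half-line may be inserted and pulled out with the weight.\<close>
    fix r :: real
    have "(\<integral>\<^sup>+ h. \<psi> h * (?w r * of_bool (norm h < r)) \<partial>lborel) =
        (\<integral>\<^sup>+ h. ?w r * indicator {0<..} r * (\<psi> h * indicator (ball 0 r) h) \<partial>lborel)"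
      by (intro nn_integral_cong)
        (auto simp: indicator_def mult_ac intro: le_less_trans[OF norm_ge_zero])
    then show "(\<integral>\<^sup>+ h. \<psi> h * (?w r * of_bool (norm h < r)) \<partial>lborel) =
        ?w r * indicator {0<..} r * (\<integral>\<^sup>+ h. \<psi> h * indicator (ball 0 r) h \<partial>lborel)"
      by (simp only:) (rule nn_integral_cmult, measurable)
  qed
  finally show ?thesis .
qed

lemma nn_integral_ball_homogeneous:
  fixes \<phi> :: "'a::euclidean_space \<Rightarrow> ennreal"
  assumes [measurable]: "\<phi> \<in> borel_measurable borel"
    and hom: "\<And>t h. 0 < t \<Longrightarrow> \<phi> (t *\<^sub>R h) = \<phi> h" and r: "0 < r"
  shows "(\<integral>\<^sup>+ h. \<phi> h * indicator (ball 0 r) h \<partial>lborel) =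
    ennreal (r ^ DIM('a)) * (\<integral>\<^sup>+ h. \<phi> h * indicator (ball 0 1) h \<partial>lborel)"
proof -
  have "indicator (ball 0 r) (r *\<^sub>R h) = (indicator (ball 0 1) h :: ennreal)" for h :: 'a
    using r by (auto simp: indicator_def)
  then show ?thesis
    using r by (subst nn_integral_lborel_affine[of _ r 0]) (measurable, auto simp: hom)
qed

text \<open>Polar coordinates for a function constant on rays. In the layer cake formula the two
  balls intersect in radius \<open>min \<delta> r\<close>, so the integral over \<open>r\<close>
  splits at \<open>\<delta>\<close>: the mass grows like \<open>r powr n\<close> below and is
  constant above. The hypothesis on \<open>a\<close> makes the exponent \<open>p = n - a\<close>
  positive, as the layer cake requires.\<close>

lemma nn_integral_homogeneous_powr_ball:
  fixes \<phi> :: "'a::euclidean_space \<Rightarrow> ennreal"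
  assumes [measurable]: "\<phi> \<in> borel_measurable borel"
    and hom: "\<And>t h. 0 < t \<Longrightarrow> \<phi> (t *\<^sub>R h) = \<phi> h"
    and a: "0 < a" "a < real DIM('a)" and \<delta>: "0 < \<delta>"
  shows "(\<integral>\<^sup>+ h. \<phi> h * indicator (ball 0 \<delta>) h * ennreal (norm h powr - (real DIM('a) - a)) \<partial>lborel) =
    ennreal (real DIM('a) / a * \<delta> powr a) * (\<integral>\<^sup>+ h. \<phi> h * indicator (ball 0 1) h \<partial>lborel)"
proof -
  define n p where "n = real DIM('a)" and "p = n - a"
  have p: "0 < p" using a by (simp add: p_def n_def)
  let ?\<Phi> = "\<integral>\<^sup>+ h. \<phi> h * indicator (ball 0 1) h \<partial>lborel"
  let ?w = "\<lambda>r. ennreal (p * r powr (- p - 1))"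
  have ball: "(\<integral>\<^sup>+ h. \<phi> h * indicator (ball 0 \<delta>) h * indicator (ball 0 r) h \<partial>lborel) =
      ennreal (min \<delta> r powr n) * ?\<Phi>" if r: "0 < r" for r
  proof -
    have "(\<integral>\<^sup>+ h. \<phi> h * indicator (ball 0 \<delta>) h * indicator (ball 0 r) h \<partial>lborel) =
        (\<integral>\<^sup>+ h. \<phi> h * indicator (ball 0 (min \<delta> r)) h \<partial>lborel)"
      by (intro nn_integral_cong) (auto simp: indicator_def)
    then show ?thesis
      using nn_integral_ball_homogeneous[of \<phi> "min \<delta> r"] hom r \<delta> by (simp add: n_def powr_realpow)
  qed
  have "(\<integral>\<^sup>+ h. \<phi> h * indicator (ball 0 \<delta>) h * ennreal (norm h powr - p) \<partial>lborel) =
      (\<integral>\<^sup>+ r. ?w r * indicator {0<..} r *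
        (\<integral>\<^sup>+ h. \<phi> h * indicator (ball 0 \<delta>) h * indicator (ball 0 r) h \<partial>lborel) \<partial>lborel)"
    by (rule nn_integral_layer_cake_powr[OF _ p]) measurable
  also have "\<dots> = (\<integral>\<^sup>+ r. (ennreal p * (ennreal (r powr (a - 1)) * indicator {0..\<delta>} r) +
        ennreal (\<delta> powr n) * (?w r * indicator {\<delta><..} r)) * ?\<Phi> \<partial>lborel)"
  proof (rule nn_integral_cong)
    fix r :: real
    \<comment> \<open>At \<open>r = 0\<close> both sides vanish, the right one because
      \<open>0 powr (a - 1)\<close> is 0.\<close>
    consider "r < 0" | "r = 0" | "0 < r" "r \<le> \<delta>" | "\<delta> < r" by linarith
    then show "?w r * indicator {0<..} r *
        (\<integral>\<^sup>+ h. \<phi> h * indicator (ball 0 \<delta>) h * indicator (ball 0 r) h \<partial>lborel) =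
      (ennreal p * (ennreal (r powr (a - 1)) * indicator {0..\<delta>} r) +
        ennreal (\<delta> powr n) * (?w r * indicator {\<delta><..} r)) * ?\<Phi>"
    proof cases
      case 3
      have "r powr (- p - 1) * r powr n = r powr (a - 1)"
        by (simp add: powr_add[symmetric] p_def)
      then have "ennreal (p * r powr (- p - 1)) * ennreal (r powr n) = ennreal p * ennreal (r powr (a - 1))"
        using p by (simp add: ennreal_mult'[symmetric] mult.assoc del: ennreal_mult'')
      then show ?thesis
        using 3 by (simp add: ball mult.assoc[symmetric])
    next
      case 4
      then show ?thesis
        using \<delta> by (simp add: ball) (simp add: mult_ac)
    qed (use \<delta> in auto)
  qed
  also have "\<dots> = (ennreal p * ennreal (\<delta> powr a / a) + ennreal (\<delta> powr n) * ennreal (\<delta> powr - p)) * ?\<Phi>"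
    using nn_integral_powr_from_0[of a \<delta>] nn_integral_powr_tail[of p \<delta>] a \<delta> p
    by (simp add: nn_integral_multc nn_integral_add nn_integral_cmult)
  also have "ennreal p * ennreal (\<delta> powr a / a) + ennreal (\<delta> powr n) * ennreal (\<delta> powr - p) =
      ennreal (p * (\<delta> powr a / a) + \<delta> powr n * \<delta> powr - p)"
    using p a by (subst ennreal_plus) (simp_all only: ennreal_mult' powr_ge_zero less_imp_le mult_nonneg_nonneg divide_nonneg_pos)
  \<comment> \<open>The two pieces are \<open>p / a\<close> and 1 times
    \<open>\<delta> powr a\<close>, and \<open>p / a + 1 = n / a\<close>.\<close>
  also have "p * (\<delta> powr a / a) + \<delta> powr n * \<delta> powr - p = n / a * \<delta> powr a"
    using a \<delta> by (simp add: powr_add[symmetric] p_def field_simps)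
  finally show ?thesis by (simp add: n_def p_def)
qed

text \<open>An upper bound suffices, since this part is later multiplied by a factor tending to 0.
  The layer cake formula sees the shell between radii \<open>\<delta>\<close> and \<open>r\<close>,
  which is empty for \<open>r \<le> \<delta>\<close> and is otherwise enlarged to the full
  ball.\<close>

lemma nn_integral_powr_outside_ball:
  fixes b \<delta> :: real
  assumes b: "0 < b" and \<delta>: "0 < \<delta>"
  defines "n \<equiv> real DIM('a::euclidean_space)"
  shows "(\<integral>\<^sup>+ h. indicator (- ball (0::'a) \<delta>) h * ennreal (norm h powr - (n + b)) \<partial>lborel) \<le>
    ennreal ((n + b) / b * \<delta> powr - b) * emeasure lborel (ball (0::'a) 1)"
proof -
  let ?V = "emeasure lborel (ball (0::'a) 1)"
  have n: "0 < n" by (simp add: n_def)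
  let ?w = "\<lambda>r. ennreal ((n + b) * r powr (- (n + b) - 1))"
  have "(\<integral>\<^sup>+ h. indicator (- ball (0::'a) \<delta>) h * ennreal (norm h powr - (n + b)) \<partial>lborel) =
    (\<integral>\<^sup>+ r. ?w r * indicator {0<..} r *
        (\<integral>\<^sup>+ h. indicator (- ball (0::'a) \<delta>) h * indicator (ball 0 r) h \<partial>lborel) \<partial>lborel)"
    by (rule nn_integral_layer_cake_powr) (use n b in simp_all)
  also have "\<dots> \<le> (\<integral>\<^sup>+ r. (ennreal ((n + b) / b) * ?V) * (ennreal (b * r powr (- b - 1)) * indicator {\<delta><..} r) \<partial>lborel)"
  proof (rule nn_integral_mono)
    fix r :: real
    show "?w r * indicator {0<..} r *
        (\<integral>\<^sup>+ h. indicator (- ball (0::'a) \<delta>) h * indicator (ball 0 r) h \<partial>lborel) \<le>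
      (ennreal ((n + b) / b) * ?V) * (ennreal (b * r powr (- b - 1)) * indicator {\<delta><..} r)"
    proof (cases "\<delta> < r")
      case False
      then have "indicator (- ball (0::'a) \<delta>) h * indicator (ball 0 r) h = (0::ennreal)" for h
        by (auto simp: indicator_def)
      then have "(\<integral>\<^sup>+ h. indicator (- ball (0::'a) \<delta>) h * indicator (ball 0 r) h \<partial>lborel) = 0"
        by (simp only: nn_integral_const mult_zero_left)
      then show ?thesis by simp
    next
      case True
      have "(\<integral>\<^sup>+ h. indicator (- ball (0::'a) \<delta>) h * indicator (ball 0 r) h \<partial>lborel) \<le>
          (\<integral>\<^sup>+ h. 1 * indicator (ball (0::'a) r) h \<partial>lborel)"
        by (intro nn_integral_mono) (auto simp: indicator_def)
      also have "\<dots> = ennreal (r powr n) * ?V"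
        using nn_integral_ball_homogeneous[of "\<lambda>_::'a. 1" r] True \<delta> by (simp add: n_def powr_realpow)
      finally have "?w r * indicator {0<..} r *
        (\<integral>\<^sup>+ h. indicator (- ball (0::'a) \<delta>) h * indicator (ball 0 r) h \<partial>lborel) \<le> ?w r * (ennreal (r powr n) * ?V)"
        using True \<delta> by (auto intro: mult_left_mono)
      also have "?w r * (ennreal (r powr n) * ?V) = ennreal ((n + b) * (r powr (- (n + b) - 1) * r powr n)) * ?V"
        using n b by (simp add: mult.assoc[symmetric] ennreal_mult'[symmetric])
      \<comment> \<open>Splits off \<open>(n + b) / b\<close> so that the normalised weight of
        \<open>nn_integral_powr_tail\<close> for the exponent \<open>b\<close> is left.\<close>
      also have "(n + b) * (r powr (- (n + b) - 1) * r powr n) = (n + b) / b * (b * r powr (- b - 1))"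
      proof -
        have "r powr (- (n + b) - 1) * r powr n = r powr (- b - 1)"
          by (simp add: powr_add[symmetric])
        then show ?thesis using b by simp
      qed
      also have "ennreal \<dots> = ennreal ((n + b) / b) * ennreal (b * r powr (- b - 1))"
        using b n by (intro ennreal_mult) auto
      finally show ?thesis using True by (simp add: mult_ac)
    qed
  qed
  also have "\<dots> = (ennreal ((n + b) / b) * ?V) * ennreal (\<delta> powr - b)"
    using nn_integral_powr_tail[OF b \<delta>] by (simp add: nn_integral_cmult)
  also have "\<dots> = ennreal ((n + b) / b * \<delta> powr - b) * ?V"
    using b n by (subst ennreal_mult) (simp_all add: mult_ac)
  finally show ?thesis .
qed

section \<open>Surface measure, the constant K and rotation invariance\<close>

lemma measurable_sgn_euclidean [measurable]:
  "sgn \<in> borel_measurable (borel :: 'a::euclidean_space measure)"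
  unfolding sgn_div_norm by measurable

lemma nn_integral_sphere_measure:
  fixes F :: "'a::euclidean_space \<Rightarrow> ennreal"
  assumes [measurable]: "F \<in> borel_measurable borel"
  shows "(\<integral>\<^sup>+ \<theta>. F \<theta> \<partial>sphere_measure) =
    of_nat DIM('a) * (\<integral>\<^sup>+ h. F (sgn h) * indicator (ball 0 1) h \<partial>lborel)"
proof -
  let ?B = "ball 0 1 - {0::'a}"
  have m: "sgn \<in> measurable (restrict_space lborel ?B) (restrict_space borel (sphere 0 1))"
    by (rule measurable_restrict_space3)
      (use measurable_sgn_euclidean[where 'a='a] in \<open>auto simp: norm_sgn measurable_lborel2\<close>)
  have F: "F \<in> borel_measurable (restrict_space borel (sphere 0 1))"
    by (rule measurable_restrict_space1) measurable
  have "(\<integral>\<^sup>+ \<theta>. F \<theta> \<partial>sphere_measure) =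
      of_nat DIM('a) * (\<integral>\<^sup>+ h. F (sgn h) \<partial>restrict_space lborel ?B)"
    unfolding sphere_measure_def
    by (subst nn_integral_scale_measure) (use F in \<open>simp_all add: nn_integral_distr[OF m]\<close>)
  also have "(\<integral>\<^sup>+ h. F (sgn h) \<partial>restrict_space lborel ?B) = (\<integral>\<^sup>+ h. F (sgn h) * indicator ?B h \<partial>lborel)"
    by (rule nn_integral_restrict_space) simp
  also have "\<dots> = (\<integral>\<^sup>+ h. F (sgn h) * indicator (ball 0 1) h \<partial>lborel)"
  proof (rule nn_integral_cong_AE)
    show "AE h in lborel. F (sgn h) * indicator ?B h = F (sgn h) * indicator (ball 0 1) h"
      using AE_lborel_singleton[of 0] by eventually_elim (simp add: indicator_def)
  qed
  finally show ?thesis .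
qed

text \<open>The integral of \<open>\<bar>g \<bullet> \<theta>\<bar> powr q\<close> over the sphere,
  divided by the dimension; it is spread over the solid ball to match
  \<open>nn_integral_homogeneous_powr_ball\<close>.\<close>

definition directional_integral :: "real \<Rightarrow> 'a::euclidean_space \<Rightarrow> ennreal" where
  "directional_integral q g =
     (\<integral>\<^sup>+ h. ennreal (\<bar>g \<bullet> sgn h\<bar> powr q) * indicator (ball 0 1) h \<partial>lborel)"

lemma abs_inner_sgn_le: "\<bar>g \<bullet> sgn h\<bar> \<le> norm (g::'a::real_inner)"
  using Cauchy_Schwarz_ineq2[of g "sgn h"] by (cases "h = 0") (auto simp: norm_sgn)

lemma directional_integral_finite:
  fixes g :: "'a::euclidean_space"
  assumes "0 < q"
  shows "directional_integral q g < \<infinity>"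
proof -
  have "directional_integral q g \<le> (\<integral>\<^sup>+ h. ennreal (norm g powr q) * indicator (ball (0::'a) 1) h \<partial>lborel)"
    unfolding directional_integral_def
    using assms by (intro nn_integral_mono mult_right_mono ennreal_leI powr_mono2 abs_inner_sgn_le) auto
  also have "\<dots> < \<infinity>"
    by (simp add: nn_integral_cmult_indicator emeasure_ball ennreal_mult_less_top)
  finally show ?thesis .
qed

text \<open>\<open>K_const\<close> is a Bochner integral, which defaults to 0 for nonintegrable
  functions; finiteness of the directional integral excludes this, so nothing is lost in
  \<open>enn2real\<close>.\<close>

lemma ennreal_K_const:
  fixes e :: "'a::euclidean_space"
  assumes "0 < q"
  shows "ennreal (K_const e q) = of_nat DIM('a) * directional_integral q e"
proof -
  have *: "(\<integral>\<^sup>+ \<theta>. ennreal (\<bar>e \<bullet> \<theta>\<bar> powr q) \<partial>sphere_measure) = of_nat DIM('a) * directional_integral q e"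
    unfolding directional_integral_def by (rule nn_integral_sphere_measure) measurable
  have m: "(\<lambda>\<theta>. \<bar>e \<bullet> \<theta>\<bar> powr q) \<in> borel_measurable (restrict_space borel (sphere 0 1))"
    by (rule measurable_restrict_space1) measurable
  have "K_const e q = enn2real (\<integral>\<^sup>+ \<theta>. ennreal (\<bar>e \<bullet> \<theta>\<bar> powr q) \<partial>sphere_measure)"
    unfolding K_const_def
    by (rule integral_eq_nn_integral) (use m in \<open>simp_all cong: measurable_cong_sets\<close>)
  then show ?thesis
    using directional_integral_finite[OF assms, of e]
    by (simp add: * ennreal_mult_less_top ennreal_enn2real_if ennreal_mult_eq_top_iff less_top)
qed

text \<open>Some orthogonal \<open>T\<close> sends \<open>g\<close> to
  \<open>norm g *\<^sub>R e\<close>. It commutes with \<open>sgn\<close> and preserves inner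
  products and the unit ball, so the integrand for \<open>g\<close> is the one for
  \<open>norm g *\<^sub>R e\<close> composed with \<open>T\<close>. For unit \<open>g\<close> this
  shows that the choice of \<open>e\<close> is immaterial.\<close>

lemma directional_integral_homogeneous:
  fixes g e :: "real ^ 'n"
  assumes "norm e = 1"
  shows "directional_integral q g = ennreal (norm g powr q) * directional_integral q e"
proof -
  obtain T where T: "orthogonal_transformation T" and Tg: "T g = norm g *\<^sub>R e"
    using orthogonal_transformation_exists[of g "norm g *\<^sub>R e"] assms by auto
  let ?\<psi> = "\<lambda>h. ennreal (\<bar>(norm g *\<^sub>R e) \<bullet> sgn h\<bar> powr q) * indicator (ball 0 1) h"
  have "g \<bullet> sgn h = (norm g *\<^sub>R e) \<bullet> sgn (T h)" for h
  proof -
    have "sgn (T h) = T (sgn h)"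
      by (simp add: sgn_div_norm orthogonal_transformation_norm[OF T] orthogonal_transformation_scaleR[OF T])
    then show ?thesis
      using T by (simp add: Tg[symmetric] orthogonal_transformation_def)
  qed
  then have "directional_integral q g = (\<integral>\<^sup>+ h. ?\<psi> (T h) \<partial>lborel)"
    by (simp add: directional_integral_def indicator_def orthogonal_transformation_norm[OF T])
  also have "\<dots> = (\<integral>\<^sup>+ h. ?\<psi> h \<partial>lborel)"
    by (rule nn_integral_orthogonal_transformation[OF _ T]) measurable
  also have "\<dots> = (\<integral>\<^sup>+ h. ennreal (norm g powr q) *
      (ennreal (\<bar>e \<bullet> sgn h\<bar> powr q) * indicator (ball 0 1) h) \<partial>lborel)"
    by (intro nn_integral_cong) (simp add: abs_mult powr_mult ennreal_mult mult.assoc)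
  also have "\<dots> = ennreal (norm g powr q) * directional_integral q e"
    unfolding directional_integral_def by (rule nn_integral_cmult) measurable
  finally show ?thesis .
qed

section \<open>Estimates for the differences of \<open>f\<close> and for the fractional
  integral\<close>

lemma difference_quotient_powr_approx:
  fixes f :: "'a::euclidean_space \<Rightarrow> real"
  assumes f: "GDERIV f x :> g" and q: "0 < q" and \<epsilon>: "0 < \<epsilon>"
  obtains \<delta> where "0 < \<delta>"
    "\<And>h. h \<noteq> 0 \<Longrightarrow> norm h < \<delta> \<Longrightarrow>
      \<bar>(\<bar>f x - f (x + h)\<bar> / norm h) powr q - \<bar>g \<bullet> sgn h\<bar> powr q\<bar> \<le> \<epsilon>"
proof -
  \<comment> \<open>Uniform continuity on a compact interval carries closeness over to the powers
    for every \<open>q > 0\<close>, including \<open>q < 1\<close>, where the power is not Lipschitz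
    at 0.\<close>
  have "uniformly_continuous_on {0..norm g + 1} (\<lambda>u. u powr q)"
    using q by (intro compact_uniformly_continuous continuous_on_powr' continuous_intros) auto
  then obtain \<eta> where \<eta>: "0 < \<eta>"
    "\<And>u v. u \<in> {0..norm g + 1} \<Longrightarrow> v \<in> {0..norm g + 1} \<Longrightarrow> \<bar>u - v\<bar> < \<eta> \<Longrightarrow> \<bar>u powr q - v powr q\<bar> < \<epsilon>"
    using \<epsilon> unfolding uniformly_continuous_on_def dist_real_def by metis
  \<comment> \<open>The bound 1 keeps the quotient in \<open>{0..norm g + 1}\<close>; the half gives
    the strict inequality that \<open>\<eta>\<close> demands.\<close>
  define \<eta>' where "\<eta>' = min 1 (\<eta> / 2)"
  have \<eta>': "0 < \<eta>'" "\<eta>' \<le> 1" "\<eta>' < \<eta>" using \<eta>(1) by (auto simp: \<eta>'_def)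
  from f obtain \<delta> where \<delta>: "0 < \<delta>"
    "\<And>y. norm (y - x) < \<delta> \<Longrightarrow> \<bar>f y - f x - (y - x) \<bullet> g\<bar> \<le> \<eta>' * norm (y - x)"
    unfolding gderiv_def has_derivative_at_alt using \<eta>'(1) by (metis real_norm_def)
  show thesis
  proof (rule that[OF \<delta>(1)])
    fix h :: 'a assume h: "h \<noteq> 0" "norm h < \<delta>"
    let ?u = "\<bar>f x - f (x + h)\<bar> / norm h" and ?v = "\<bar>g \<bullet> sgn h\<bar>"
    have v: "?v = \<bar>h \<bullet> g\<bar> / norm h"
      by (simp add: sgn_div_norm inner_commute abs_mult divide_inverse)
    have "\<bar>\<bar>f x - f (x + h)\<bar> - \<bar>h \<bullet> g\<bar>\<bar> \<le> \<eta>' * norm h"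
      using \<delta>(2)[of "x + h"] h by simp
    then have "\<bar>?u - ?v\<bar> \<le> \<eta>'"
      using h by (simp add: v diff_divide_distrib[symmetric] divide_le_eq)
    then show "\<bar>?u powr q - ?v powr q\<bar> \<le> \<epsilon>"
      using \<eta>' abs_inner_sgn_le[of g h] by (intro less_imp_le \<eta>(2)) auto
  qed
qed

lemma C1_compact_support_bounded:
  fixes f :: "'a::euclidean_space \<Rightarrow> real"
  assumes "C1_compact_support f"
  obtains M where "0 \<le> M" "\<And>x y. \<bar>f x - f y\<bar> \<le> M"
proof -
  have "continuous_on UNIV f"
    using assms unfolding C1_compact_support_def
    by (intro continuous_at_imp_continuous_on ballI differentiable_imp_continuous_within) auto
  then have "compact (f ` closure (support_on UNIV f))"
    using assms unfolding C1_compact_support_def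
    by (intro compact_continuous_image) (auto intro: continuous_on_subset)
  then obtain C where C: "\<And>x. x \<in> closure (support_on UNIV f) \<Longrightarrow> \<bar>f x\<bar> \<le> C"
    by (force simp: bounded_iff dest: compact_imp_bounded)
  \<comment> \<open>If the support is empty, \<open>C\<close> is unconstrained and may be negative,
    hence its absolute value.\<close>
  have "\<bar>f x\<bar> \<le> \<bar>C\<bar>" for x
  proof (cases "f x = 0")
    case False
    then have "x \<in> closure (support_on UNIV f)"
      by (intro subsetD[OF closure_subset]) (simp add: support_on_def)
    with C[of x] show ?thesis by simp
  qed simp
  then have "\<bar>f x - f y\<bar> \<le> \<bar>C\<bar> + \<bar>C\<bar>" for x y
    by (intro order_trans[OF abs_triangle_ineq4] add_mono)
  then show thesis by (intro that[of "\<bar>C\<bar> + \<bar>C\<bar>"]) auto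
qed

text \<open>Pointwise comparison: with the leading term up to \<open>\<epsilon>\<close> inside the
  ball of radius \<open>\<delta>\<close>, and with \<open>M\<close> outside. The leading term
  integrates exactly to \<open>c * directional_integral q g\<close>. The lower bound discards the
  outside part and adds the error to the larger side, which avoids subtraction in
  \<open>ennreal\<close>.\<close>

lemma frac_integral_bounds:
  fixes f :: "'a::euclidean_space \<Rightarrow> real"
  assumes [measurable]: "f \<in> borel_measurable borel"
    and q: "0 < q" and s: "0 < s" "s < 1" "q * (1 - s) < real DIM('a)"
    and \<delta>: "0 < \<delta>" and \<epsilon>: "0 < \<epsilon>"
    and near: "\<And>h. h \<noteq> 0 \<Longrightarrow> norm h < \<delta> \<Longrightarrow>
      \<bar>(\<bar>f x - f (x + h)\<bar> / norm h) powr q - \<bar>g \<bullet> sgn h\<bar> powr q\<bar> \<le> \<epsilon>"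
    and M: "0 \<le> M" "\<And>y. \<bar>f x - f y\<bar> \<le> M"
  defines "n \<equiv> real DIM('a)"
    and "V \<equiv> emeasure lborel (ball (0::'a) 1)"
    and "J \<equiv> \<integral>\<^sup>+ y. ennreal (\<bar>f x - f y\<bar> powr q / norm (x - y) powr (real DIM('a) + s * q)) \<partial>lborel"
    and "c \<equiv> ennreal (real DIM('a) / (q * (1 - s)) * \<delta> powr (q * (1 - s)))"
  shows "J \<le> c * directional_integral q g + c * (ennreal \<epsilon> * V) +
      ennreal (M powr q) * (ennreal ((n + s * q) / (s * q) * \<delta> powr - (s * q)) * V)"
    and "c * directional_integral q g \<le> J + c * (ennreal \<epsilon> * V)"
proof -
  define a where "a = q * (1 - s)"
  have a: "0 < a" "a < n" using q s by (auto simp: a_def n_def)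
  define N where "N h = \<bar>f x - f (x + h)\<bar> powr q / norm h powr (n + s * q)" for h
  let ?\<phi> = "\<lambda>h. ennreal (\<bar>g \<bullet> sgn h\<bar> powr q)"
  let ?B = "indicator (ball 0 \<delta>) :: 'a \<Rightarrow> ennreal"
  let ?C = "indicator (- ball 0 \<delta>) :: 'a \<Rightarrow> ennreal"
  let ?w = "\<lambda>h::'a. ennreal (norm h powr - (n - a))"
  let ?W = "\<lambda>h::'a. ennreal (norm h powr - (n + s * q))"
  have N [measurable]: "N \<in> borel_measurable borel" unfolding N_def by measurable
  have J: "J = (\<integral>\<^sup>+ h. ennreal (N h) \<partial>lborel)"
    unfolding J_def
    by (subst nn_integral_lborel_translate[where t = x, symmetric])
      (measurable, simp add: N_def n_def add.commute)
  \<comment> \<open>The exponent splits as \<open>n + s * q = q + (n - a)\<close>: the power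
    \<open>q\<close> of the norm goes into the difference quotient, the rest is the weight
    \<open>?w\<close>.\<close>
  have N_eq: "N h = (\<bar>f x - f (x + h)\<bar> / norm h) powr q * norm h powr - (n - a)" if "h \<noteq> 0" for h
  proof -
    have "norm h powr (n + s * q) = norm h powr q * norm h powr (n - a)"
      by (simp add: powr_add[symmetric] a_def algebra_simps)
    then show ?thesis
      unfolding N_def powr_minus powr_divide by (simp add: field_simps)
  qed
  \<comment> \<open>\<open>?\<phi>\<close> is constant on rays because it depends on
    \<open>h\<close> only through \<open>sgn h\<close>.\<close>
  have near_\<phi>: "(\<integral>\<^sup>+ h. ?\<phi> h * ?B h * ?w h \<partial>lborel) = c * directional_integral q g"
    unfolding directional_integral_def c_def n_def a_def
    by (rule nn_integral_homogeneous_powr_ball) (use a \<delta> in \<open>simp_all add: a_def n_def sgn_scaleR\<close>)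
  have near_\<epsilon>: "(\<integral>\<^sup>+ h. ennreal \<epsilon> * ?B h * ?w h \<partial>lborel) = c * (ennreal \<epsilon> * V)"
    using nn_integral_homogeneous_powr_ball[of "\<lambda>_::'a. ennreal \<epsilon>" a \<delta>] a \<delta>
    by (simp add: c_def n_def a_def V_def nn_integral_cmult)
  have far: "(\<integral>\<^sup>+ h. ?C h * ?W h \<partial>lborel) \<le> ennreal ((n + s * q) / (s * q) * \<delta> powr - (s * q)) * V"
    unfolding n_def V_def using q s \<delta> by (intro nn_integral_powr_outside_ball) auto
  have "J \<le> (\<integral>\<^sup>+ h. (?\<phi> h * ?B h * ?w h + ennreal \<epsilon> * ?B h * ?w h) + ennreal (M powr q) * (?C h * ?W h) \<partial>lborel)"
    unfolding J
  proof (rule nn_integral_mono)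
    fix h :: 'a
    consider "h = 0" | "h \<noteq> 0" "norm h < \<delta>" | "\<delta> \<le> norm h" "h \<noteq> 0" using \<delta> by fastforce
    then show "ennreal (N h) \<le> (?\<phi> h * ?B h * ?w h + ennreal \<epsilon> * ?B h * ?w h) + ennreal (M powr q) * (?C h * ?W h)"
    proof cases
      case 1
      then show ?thesis by (simp add: N_def)
    next
      case 2
      have "N h \<le> (\<bar>g \<bullet> sgn h\<bar> powr q + \<epsilon>) * norm h powr - (n - a)"
        unfolding N_eq[OF 2(1)] using near[OF 2] by (intro mult_right_mono) auto
      then have "ennreal (N h) \<le> (?\<phi> h + ennreal \<epsilon>) * ?w h"
        using \<epsilon> by (simp add: ennreal_plus[symmetric] ennreal_mult'[symmetric] ennreal_leI del: ennreal_plus)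
      then show ?thesis using 2 by (simp add: distrib_right)
    next
      case 3
      have "N h \<le> M powr q * norm h powr - (n + s * q)"
        unfolding N_def powr_minus divide_inverse
        using M q by (intro mult_right_mono powr_mono2) auto
      then show ?thesis using 3 by (simp add: ennreal_mult'[symmetric] ennreal_leI)
    qed
  qed
  also have "\<dots> = (\<integral>\<^sup>+ h. ?\<phi> h * ?B h * ?w h \<partial>lborel) + (\<integral>\<^sup>+ h. ennreal \<epsilon> * ?B h * ?w h \<partial>lborel) +
      ennreal (M powr q) * (\<integral>\<^sup>+ h. ?C h * ?W h \<partial>lborel)"
    by (simp add: nn_integral_add nn_integral_cmult)
  also have "\<dots> \<le> c * directional_integral q g + c * (ennreal \<epsilon> * V) +
      ennreal (M powr q) * (ennreal ((n + s * q) / (s * q) * \<delta> powr - (s * q)) * V)"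
    unfolding near_\<phi> near_\<epsilon> by (intro add_left_mono mult_left_mono far) simp
  finally show "J \<le> c * directional_integral q g + c * (ennreal \<epsilon> * V) +
      ennreal (M powr q) * (ennreal ((n + s * q) / (s * q) * \<delta> powr - (s * q)) * V)" .
  have "c * directional_integral q g \<le> (\<integral>\<^sup>+ h. ennreal (N h) + ennreal \<epsilon> * ?B h * ?w h \<partial>lborel)"
    unfolding near_\<phi>[symmetric]
  proof (rule nn_integral_mono)
    fix h :: 'a
    consider "h = 0" | "h \<noteq> 0" "norm h < \<delta>" | "\<delta> \<le> norm h" by fastforce
    then show "?\<phi> h * ?B h * ?w h \<le> ennreal (N h) + ennreal \<epsilon> * ?B h * ?w h"
    proof cases
      case 2
      have "\<bar>g \<bullet> sgn h\<bar> powr q * norm h powr - (n - a) \<le>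
          ((\<bar>f x - f (x + h)\<bar> / norm h) powr q + \<epsilon>) * norm h powr - (n - a)"
        using near[OF 2] by (intro mult_right_mono) auto
      also have "\<dots> = N h + \<epsilon> * norm h powr - (n - a)"
        by (simp add: N_eq[OF 2(1)] distrib_right)
      finally have "ennreal (\<bar>g \<bullet> sgn h\<bar> powr q * norm h powr - (n - a)) \<le> ennreal (N h + \<epsilon> * norm h powr - (n - a))"
        by (rule ennreal_leI)
      then show ?thesis
        using 2 \<epsilon> by (simp add: ennreal_mult N_def)
    qed (use q in simp_all)
  qed
  also have "\<dots> = J + c * (ennreal \<epsilon> * V)"
    unfolding near_\<epsilon>[symmetric] J by (rule nn_integral_add) measurable
  finally show "c * directional_integral q g \<le> J + c * (ennreal \<epsilon> * V)" .
qed

section \<open>Passage to the limit in \<open>s\<close>\<close>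

theorem theorem3p1:
  fixes f :: "real ^ 'n \<Rightarrow> real" and q :: real and e x :: "real ^ 'n"
  assumes "0 < q"
    and "C1_compact_support f"
    and "norm e = 1"
  shows "((\<lambda>s. ennreal ((q * (1 - s)) powr (1 / q)) * frac_deriv s q f x)
            \<longlongrightarrow> ennreal (K_const e q powr (1 / q) * norm (grad f x))) (at_left 1)"
proof -
  define n where "n = real DIM(real ^ 'n)"
  define g where "g = grad f x"
  define J where "J s = (\<integral>\<^sup>+ y. ennreal (\<bar>f x - f y\<bar> powr q /
      norm (x - y) powr (real DIM(real ^ 'n) + s * q)) \<partial>lborel)" for s
  have J_eq: "(\<integral>\<^sup>+ y. ennreal (\<bar>f x - f y\<bar> powr q /
      norm (x - y) powr (real CARD('n) + s * q)) \<partial>lborel) = J s" for s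
    by (simp add: J_def)
  define P where "P = enn2real (directional_integral q g)"
  define v where "v = measure lborel (ball (0::real ^ 'n) 1)"
  note q = \<open>0 < q\<close>
  have n: "0 < n" by (simp add: n_def)
  have P: "directional_integral q g = ennreal P" "0 \<le> P"
    using directional_integral_finite[OF q, of g] by (simp_all add: P_def less_top)
  have v: "emeasure lborel (ball (0::real ^ 'n) 1) = ennreal v" "0 < v"
    by (simp_all add: v_def emeasure_ball content_ball)
  have f: "GDERIV f x :> g"
    using assms(2) unfolding g_def C1_compact_support_def by (intro gderiv_grad) auto
  have [measurable]: "f \<in> borel_measurable borel"
    using assms(2) unfolding C1_compact_support_def
    by (intro borel_measurable_continuous_onI continuous_at_imp_continuous_on ballI
        differentiable_imp_continuous_within) auto
  obtain M where M: "0 \<le> M" "\<And>x y. \<bar>f x - f y\<bar> \<le> M"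
    using C1_compact_support_bounded[OF assms(2)] by blast
  \<comment> \<open>The bounds of \<open>frac_integral_bounds\<close> multiplied by
    \<open>q * (1 - s)\<close>, which cancels the pole of \<open>c\<close> at \<open>s = 1\<close>.
    In the limit \<open>\<delta> powr (q * (1 - s))\<close> becomes 1 and the far term 0, leaving
    \<open>n * (P - \<epsilon> * v)\<close> and \<open>n * (P + \<epsilon> * v)\<close>.\<close>
  define L U where "L \<delta> \<epsilon> s = n * \<delta> powr (q * (1 - s)) * (P - \<epsilon> * v)"
    and "U \<delta> \<epsilon> s = n * \<delta> powr (q * (1 - s)) * (P + \<epsilon> * v) +
      q * (1 - s) * (M powr q * ((n + s * q) / (s * q) * \<delta> powr - (s * q) * v))" for \<delta> \<epsilon> s :: real
  have s_ev: "eventually (\<lambda>s. 0 < s \<and> s < 1 \<and> q * (1 - s) < n) (at_left 1)"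
  proof -
    have "((\<lambda>s. q * (1 - s)) \<longlongrightarrow> q * (1 - 1)) (at_left (1::real))"
      by (intro tendsto_intros)
    then have "eventually (\<lambda>s. q * (1 - s) < n) (at_left 1)"
      using n by (intro order_tendstoD(2)) auto
    moreover have "eventually (\<lambda>s. s \<in> {0<..<1::real}) (at_left 1)"
      by (rule eventually_at_leftI[of 0]) auto
    ultimately show ?thesis by eventually_elim auto
  qed
  \<comment> \<open>\<open>\<delta>\<close> depends on \<open>\<epsilon>\<close> but not on
    \<open>s\<close>, so \<open>s\<close> can tend to 1 with \<open>\<epsilon>\<close> and
    \<open>\<delta>\<close> fixed.\<close>
  have bounds: "\<exists>\<delta>>0. \<forall>s. 0 < s \<and> s < 1 \<and> q * (1 - s) < n \<longrightarrow>
      J s < \<infinity> \<and> L \<delta> \<epsilon> s \<le> q * (1 - s) * enn2real (J s) \<and> q * (1 - s) * enn2real (J s) \<le> U \<delta> \<epsilon> s"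
    if \<epsilon>: "0 < \<epsilon>" for \<epsilon>
  proof -
    obtain \<delta> where \<delta>: "0 < \<delta>" "\<And>h. h \<noteq> 0 \<Longrightarrow> norm h < \<delta> \<Longrightarrow>
      \<bar>(\<bar>f x - f (x + h)\<bar> / norm h) powr q - \<bar>g \<bullet> sgn h\<bar> powr q\<bar> \<le> \<epsilon>"
      using difference_quotient_powr_approx[OF f q \<epsilon>] by blast
    show ?thesis
    proof (intro exI[of _ \<delta>] conjI allI impI \<delta>(1); elim conjE)
      fix s :: real assume s: "0 < s" "s < 1" "q * (1 - s) < n"
      define a c k T where "a = q * (1 - s)" and "c = n / a * \<delta> powr a"
        and "k = (n + s * q) / (s * q) * \<delta> powr - (s * q)" and "T = M powr q * (k * v)"
      have a: "0 < a" using q s by (simp add: a_def)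
      have c: "0 < c" using a n \<delta>(1) by (simp add: c_def)
      have k: "0 \<le> k" using q s n by (simp add: k_def)
      have T: "0 \<le> T" using k v by (simp add: T_def)
      note B = frac_integral_bounds[where f = f and x = x and s = s and M = M and g = g,
          OF _ q s(1,2) s(3)[unfolded n_def] \<delta>(1) \<epsilon> \<delta>(2) M,
          folded J_def n_def a_def, folded c_def k_def, unfolded P v]
      have "J s \<le> ennreal c * ennreal P + ennreal c * (ennreal \<epsilon> * ennreal v) +
          ennreal (M powr q) * (ennreal k * ennreal v)"
        by (rule B) auto
      also have "\<dots> = ennreal (c * P + c * (\<epsilon> * v) + T)"
        using c P \<epsilon> v k by (simp add: T_def ennreal_mult ennreal_plus)
      finally have up: "J s \<le> ennreal (c * P + c * (\<epsilon> * v) + T)" .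
      \<comment> \<open>Finiteness makes \<open>enn2real (J s)\<close> the true value and not the
        default 0 at infinity.\<close>
      then show fin: "J s < \<infinity>" by (simp add: le_less_trans)
      define j where "j = enn2real (J s)"
      have j: "J s = ennreal j" "0 \<le> j" using fin by (simp_all add: j_def less_top)
      have "ennreal c * ennreal P \<le> J s + ennreal c * (ennreal \<epsilon> * ennreal v)"
        by (rule B) auto
      then have "ennreal (c * P) \<le> ennreal (j + c * (\<epsilon> * v))"
        using c P \<epsilon> v j by (simp add: ennreal_mult ennreal_plus)
      then have lo: "c * P \<le> j + c * (\<epsilon> * v)"
        using c \<epsilon> v j by (subst (asm) ennreal_le_iff) auto
      have hi: "j \<le> c * P + c * (\<epsilon> * v) + T"
        using up c P \<epsilon> v T unfolding j by (subst (asm) ennreal_le_iff) auto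
      have ac: "a * c = n * \<delta> powr a" using a by (simp add: c_def)
      have "a * (c * (P - \<epsilon> * v)) \<le> a * j"
        using a lo by (intro mult_left_mono) (simp_all add: algebra_simps)
      then show "L \<delta> \<epsilon> s \<le> q * (1 - s) * enn2real (J s)"
        unfolding L_def a_def[symmetric] j_def[symmetric] ac[symmetric] by (simp add: mult.assoc)
      have "a * j \<le> a * (c * (P + \<epsilon> * v) + T)"
        using a hi by (intro mult_left_mono) (simp_all add: algebra_simps)
      then show "q * (1 - s) * enn2real (J s) \<le> U \<delta> \<epsilon> s"
        unfolding U_def a_def[symmetric] j_def[symmetric] k_def[symmetric] T_def[symmetric] ac[symmetric]
        by (simp add: algebra_simps)
    qed
  qed
  have lim: "((\<lambda>s. q * (1 - s) * enn2real (J s)) \<longlongrightarrow> n * P) (at_left 1)"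
  proof (rule order_tendstoI)
    fix l assume l: "l < n * P"
    \<comment> \<open>Makes \<open>n * \<epsilon> * v\<close> half the gap between \<open>l\<close>
      and \<open>n * P\<close>.\<close>
    define \<epsilon> where "\<epsilon> = (n * P - l) / (2 * n * v)"
    have \<epsilon>: "0 < \<epsilon>" using l n v by (simp add: \<epsilon>_def)
    have n\<epsilon>: "n * (P - \<epsilon> * v) > l"
      using l n v by (simp add: \<epsilon>_def field_simps)
    obtain \<delta> where \<delta>: "0 < \<delta>" and b: "\<And>s. 0 < s \<and> s < 1 \<and> q * (1 - s) < n \<Longrightarrow> L \<delta> \<epsilon> s \<le> q * (1 - s) * enn2real (J s)"
      using bounds[OF \<epsilon>] by blast
    have "(L \<delta> \<epsilon> \<longlongrightarrow> n * \<delta> powr (q * (1 - 1)) * (P - \<epsilon> * v)) (at_left 1)"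
      unfolding L_def using \<delta> by (intro tendsto_intros) auto
    then have "eventually (\<lambda>s. l < L \<delta> \<epsilon> s) (at_left 1)"
      using n\<epsilon> \<delta> by (intro order_tendstoD(1)) auto
    then show "eventually (\<lambda>s. l < q * (1 - s) * enn2real (J s)) (at_left 1)"
      using s_ev by eventually_elim (use b in \<open>auto intro: less_le_trans\<close>)
  next
    fix u assume u: "n * P < u"
    define \<epsilon> where "\<epsilon> = (u - n * P) / (2 * n * v)"
    have \<epsilon>: "0 < \<epsilon>" using u n v by (simp add: \<epsilon>_def)
    have n\<epsilon>: "n * (P + \<epsilon> * v) < u"
      using u n v by (simp add: \<epsilon>_def field_simps)
    obtain \<delta> where \<delta>: "0 < \<delta>" and b: "\<And>s. 0 < s \<and> s < 1 \<and> q * (1 - s) < n \<Longrightarrow> q * (1 - s) * enn2real (J s) \<le> U \<delta> \<epsilon> s"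
      using bounds[OF \<epsilon>] by blast
    have "(U \<delta> \<epsilon> \<longlongrightarrow> n * \<delta> powr (q * (1 - 1)) * (P + \<epsilon> * v) +
      q * (1 - 1) * (M powr q * ((n + 1 * q) / (1 * q) * \<delta> powr - (1 * q) * v))) (at_left 1)"
      unfolding U_def using \<delta> q by (intro tendsto_intros) auto
    then have "eventually (\<lambda>s. U \<delta> \<epsilon> s < u) (at_left 1)"
      using n\<epsilon> \<delta> by (intro order_tendstoD(2)) auto
    then show "eventually (\<lambda>s. q * (1 - s) * enn2real (J s) < u) (at_left 1)"
      using s_ev by eventually_elim (use b in \<open>auto intro: le_less_trans\<close>)
  qed
  \<comment> \<open>The integral for the gradient is reduced to the one for \<open>e\<close>; the
    factor \<open>n\<close> is the normalisation of the cone measure.\<close>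
  have nP: "n * P = norm g powr q * K_const e q"
  proof -
    have "0 \<le> K_const e q" unfolding K_const_def by (rule integral_nonneg_AE) simp
    have "ennreal (n * P) = of_nat DIM(real ^ 'n) * directional_integral q g"
      using n P by (simp add: n_def ennreal_mult ennreal_of_nat_eq_real_of_nat)
    also have "\<dots> = ennreal (norm g powr q) * ennreal (K_const e q)"
      by (simp add: directional_integral_homogeneous[OF assms(3), of q g] ennreal_K_const[OF q] mult_ac)
    also have "\<dots> = ennreal (norm g powr q * K_const e q)"
      using \<open>0 \<le> K_const e q\<close> by (simp add: ennreal_mult)
    finally show ?thesis
      using n P \<open>0 \<le> K_const e q\<close> by (subst (asm) ennreal_inj) auto
  qed
  have "((\<lambda>s. ennreal ((q * (1 - s) * enn2real (J s)) powr (1 / q))) \<longlongrightarrow> ennreal ((n * P) powr (1 / q))) (at_left 1)"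
  \<comment> \<open>The limit \<open>n * P\<close> is 0 when the gradient vanishes, so continuity of
    the power at 0 is used; it relies on nonnegative arguments and a positive exponent.\<close>
  proof (intro tendsto_ennrealI tendsto_powr2 lim tendsto_const)
    show "\<forall>\<^sub>F s in at_left 1. 0 \<le> q * (1 - s) * enn2real (J s)"
      using s_ev by eventually_elim (use q in simp)
  qed (use q in simp)
  also have "(n * P) powr (1 / q) = K_const e q powr (1 / q) * norm (grad f x)"
    unfolding nP using q by (simp add: powr_mult powr_powr g_def mult.commute)
  finally show ?thesis
  proof (rule Lim_transform_eventually)
    \<comment> \<open>Selects the finite branch of \<open>ennreal_powr\<close> for \<open>s\<close>
      close to 1.\<close>
    have fin: "J s < \<infinity>" if "0 < s \<and> s < 1 \<and> q * (1 - s) < n" for s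
      using bounds[of 1] that by auto
    show "\<forall>\<^sub>F s in at_left 1. ennreal ((q * (1 - s) * enn2real (J s)) powr (1 / q)) =
        ennreal ((q * (1 - s)) powr (1 / q)) * frac_deriv s q f x"
      using s_ev
    proof eventually_elim
      case (elim s)
      then show ?case
        using fin[OF elim] q
        by (simp add: frac_deriv_def J_eq ennreal_powr_def less_top powr_mult ennreal_mult)
    qed
  qed
qed

end
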